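(* Let $A$ and $B$ be Banach algebras with bounded approximate identities and let $(E^{<},E^{>})$ be a Morita equivalence between them. Let $I$ be a closed two-sided ideal of $B$ and set $J=\operatorname{Ind}_B^A(I)$, a closed two-sided ideal of $A$. Put $$X:=E_I^{>},\qquad Y:={}_IE^{<}.$$ Then the original pairings restrict to $I$- and $J$-valued pairings on $Y\times X$ and $X\times Y$, respectively, and $$\overline{\operatorname{span}}\,\langle Y,X\rangle_B=I^2,\qquad \overline{\operatorname{span}}\,{}_A\langle X,Y\rangle=J^2.$$
   Context: All Banach spaces and Banach algebras are complex, and all Banach module actions are contractive. For a subset $S$ of a Banach space, $\overline{\operatorname{span}}\,S$ is its closed linear span. For sets $S,T$ a pairing symbol applied to $(S,T)$ denotes the set of all values on $S\times T$. A bounded approximate identity in a Banach algebra $A$ is a net $(u_\lambda)$ with $\sup_\lambda\|u_\lambda\|<\infty$ and $u_\lambda a\to a$, $au_\lambda\to a$ for every $a\in A$. A Morita equivalence $(E^{<},E^{>})$ between Banach algebras $A$ and $B$ consists of a Banach $B$-$A$-bimodule $E^{<}$, a Banach $A$-$B$-bimodule $E^{>}$, and continuous bilinear pairings $\langle\cdot,\cdot\rangle_B:E^{<}\times E^{>}\to B$ and ${}_A\langle\cdot,\cdot\rangle:E^{>}\times E^{<}\to A$ of norm at most one such that, for all $e^{<},f^{<}\in E^{<}$, $e^{>},f^{>}\in E^{>}$, $a\in A$, $b\in B$: (i) $\langle be^{<},e^{>}\rangle_B=b\langle e^{<},e^{>}\rangle_B$, $\langle e^{<},e^{>}b\rangle_B=\langle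 e^{<},e^{>}\rangle_Bb$, ${}_A\langle ae^{>},e^{<}\rangle=a\,{}_A\langle e^{>},e^{<}\rangle$, ${}_A\langle e^{>},e^{<}a\rangle={}_A\langle e^{>},e^{<}\rangle a$; (ii) $\langle e^{<}a,e^{>}\rangle_B=\langle e^{<},ae^{>}\rangle_B$, ${}_A\langle e^{>}b,e^{<}\rangle={}_A\langle e^{>},be^{<}\rangle$; (iii) $\langle e^{<},e^{>}\rangle_Bf^{<}=e^{<}\,{}_A\langle e^{>},f^{<}\rangle$, $e^{>}\langle f^{<},f^{>}\rangle_B={}_A\langle e^{>},f^{<}\rangle f^{>}$; (iv) both pairings are full: $\overline{\operatorname{span}}\,\langle E^{<},E^{>}\rangle_B=B$ and $\overline{\operatorname{span}}\,{}_A\langle E^{>},E^{<}\rangle=A$; (v) all four module actions are nondegenerate, i.e. the linear span of the module products is dense in the module. For a closed two-sided ideal $I$ of $B$ put $E_I^{>}=\{\xi\in E^{>}:\langle\eta,\xi\rangle_B\in I\ \forall\eta\in E^{<}\}$, ${}_IE^{<}=\{\eta\in E^{<}:\langle\eta,\xi\rangle_B\in I\ \forall\xi\in E^{>}\}$ and $\operatorname{Ind}_B^A(I)=\overline{\operatorname{span}}\,{}_A\langle E_I^{>},E^{<}\rangle$. For a closed ideal $K$ of a Banach algebra, $K^2:=\overline{\operatorname{span}}\,\{k_1k_2:k_1,k_2\in K\}$. *)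

theory Defs
  imports "HOL-Analysis.Analysis"
begin

(* The library has only real Banach spaces.  The complex scalar action extends the given real one,
   so the topology, norm and completeness are those of the library class banach. *)
class complex_banach = banach +
  fixes scaleC :: "complex \<Rightarrow> 'a \<Rightarrow> 'a"  (infixr \<open>*\<^sub>C\<close> 75)
  assumes scaleC_add_right: "c *\<^sub>C (x + y) = c *\<^sub>C x + c *\<^sub>C y"
    and scaleC_add_left: "(c + d) *\<^sub>C x = c *\<^sub>C x + d *\<^sub>C x"
    and scaleC_scaleC: "c *\<^sub>C d *\<^sub>C x = (c * d) *\<^sub>C x"
    and scaleC_of_real: "complex_of_real r *\<^sub>C x = r *\<^sub>R x"
    and norm_scaleC: "norm (c *\<^sub>C x) = cmod c * norm x"

(* Not assumed unital; submultiplicativity of the norm comes from real_normed_algebra. *)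
class complex_banach_algebra = complex_banach + real_normed_algebra +
  assumes mult_scaleC_left: "(c *\<^sub>C x) * y = c *\<^sub>C (x * y)"
    and mult_scaleC_right: "x * (c *\<^sub>C y) = c *\<^sub>C (x * y)"

global_interpretation complex_vector: vector_space "scaleC :: complex \<Rightarrow> 'a::complex_banach \<Rightarrow> 'a"
proof
  show "1 *\<^sub>C x = x" for x :: 'a
    using scaleC_of_real[of 1 x] by simp
qed (simp_all add: scaleC_add_right scaleC_add_left scaleC_scaleC)

definition closed_span :: "'a::complex_banach set \<Rightarrow> 'a set" where
  "closed_span S = closure (complex_vector.span S)"

definition pair_values :: "('x \<Rightarrow> 'y \<Rightarrow> 'z) \<Rightarrow> 'x set \<Rightarrow> 'y set \<Rightarrow> 'z set" where
  "pair_values p S T = {p s t | s t. s \<in> S \<and> t \<in> T}"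

definition contractive_bilinear ::
  "('x::complex_banach \<Rightarrow> 'y::complex_banach \<Rightarrow> 'z::complex_banach) \<Rightarrow> bool" where
  "contractive_bilinear p \<longleftrightarrow>
     (\<forall>y. Vector_Spaces.linear scaleC scaleC (\<lambda>x. p x y)) \<and>
     (\<forall>x. Vector_Spaces.linear scaleC scaleC (\<lambda>y. p x y)) \<and>
     (\<forall>x y. norm (p x y) \<le> norm x * norm y)"


definition directed_set :: "'i set \<Rightarrow> ('i \<Rightarrow> 'i \<Rightarrow> bool) \<Rightarrow> bool" where
  "directed_set D le \<longleftrightarrow> D \<noteq> {} \<and> (\<forall>i\<in>D. le i i) \<and>
     (\<forall>i\<in>D. \<forall>j\<in>D. \<forall>k\<in>D. le i j \<longrightarrow> le j k \<longrightarrow> le i k) \<and>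
     (\<forall>i\<in>D. \<forall>j\<in>D. \<exists>k\<in>D. le i k \<and> le j k)"

definition net_filter :: "'i set \<Rightarrow> ('i \<Rightarrow> 'i \<Rightarrow> bool) \<Rightarrow> 'i filter" where
  "net_filter D le = (INF i\<in>D. principal {j\<in>D. le i j})"

lemma eventually_net_filter:
  assumes "directed_set D le"
  shows "eventually P (net_filter D le) \<longleftrightarrow> (\<exists>i\<in>D. \<forall>j\<in>D. le i j \<longrightarrow> P j)"
proof -
  have "eventually P (net_filter D le) \<longleftrightarrow>
      (\<exists>i\<in>D. eventually P (principal {j\<in>D. le i j}))"
    unfolding net_filter_def
  proof (rule eventually_INF_base)
    show "D \<noteq> {}"
      using assms by (simp add: directed_set_def)
    fix i j assume ij: "i \<in> D" "j \<in> D"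
    then obtain k where k: "k \<in> D" "le i k" "le j k"
      using assms unfolding directed_set_def by blast
    have "{l\<in>D. le k l} \<subseteq> {l\<in>D. le i l} \<inter> {l\<in>D. le j l}"
      using assms ij k unfolding directed_set_def by blast
    then show "\<exists>x\<in>D. principal {l\<in>D. le x l} \<le>
        inf (principal {l\<in>D. le i l}) (principal {l\<in>D. le j l})"
      using k(1) by (auto simp: inf_principal)
  qed
  then show ?thesis
    by (auto simp: eventually_principal)
qed

(* A Banach algebra has a bounded approximate identity iff these conditions hold for some D, le, u;
   as hypotheses with D, le, u and the index type free, they express that existence. *)
definition bounded_approximate_identity ::
  "'i set \<Rightarrow> ('i \<Rightarrow> 'i \<Rightarrow> bool) \<Rightarrow> ('i \<Rightarrow> 'a::complex_banach_algebra) \<Rightarrow> bool" where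
  "bounded_approximate_identity D le u \<longleftrightarrow>
     directed_set D le \<and> bounded (u ` D) \<and>
     (\<forall>a. ((\<lambda>i. u i * a) \<longlongrightarrow> a) (net_filter D le)) \<and>
     (\<forall>a. ((\<lambda>i. a * u i) \<longlongrightarrow> a) (net_filter D le))"


definition closed_ideal :: "'a::complex_banach_algebra set \<Rightarrow> bool" where
  "closed_ideal I \<longleftrightarrow> complex_vector.subspace I \<and> closed I \<and>
     (\<forall>a. \<forall>x\<in>I. a * x \<in> I \<and> x * a \<in> I)"

definition ideal_square :: "'a::complex_banach_algebra set \<Rightarrow> 'a set" where
  "ideal_square K = closed_span (pair_values (*) K K)"


locale banach_bimodule =
  fixes lact :: "'b::complex_banach_algebra \<Rightarrow> 'e::complex_banach \<Rightarrow> 'e"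
    and ract :: "'e \<Rightarrow> 'a::complex_banach_algebra \<Rightarrow> 'e"
  assumes lact_bilinear: "contractive_bilinear lact"
    and ract_bilinear: "contractive_bilinear ract"
    and lact_assoc: "lact (b * b') e = lact b (lact b' e)"
    and ract_assoc: "ract e (a * a') = ract (ract e a) a'"
    and lact_ract: "ract (lact b e) a = lact b (ract e a)"

(* 'el is the B-A-bimodule E^<, 'er the A-B-bimodule E^>. *)
locale morita_equivalence =
  left: banach_bimodule lB rA + right: banach_bimodule lA rB
  for lB :: "'b::complex_banach_algebra \<Rightarrow> 'el::complex_banach \<Rightarrow> 'el"
    and rA :: "'el \<Rightarrow> 'a::complex_banach_algebra \<Rightarrow> 'el"
    and lA :: "'a \<Rightarrow> 'er::complex_banach \<Rightarrow> 'er"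
    and rB :: "'er \<Rightarrow> 'b \<Rightarrow> 'er" +
  fixes pairB :: "'el \<Rightarrow> 'er \<Rightarrow> 'b"
    and pairA :: "'er \<Rightarrow> 'el \<Rightarrow> 'a"
  assumes pairB_bilinear: "contractive_bilinear pairB"
    and pairA_bilinear: "contractive_bilinear pairA"
    and pairB_lact: "pairB (lB b e) f = b * pairB e f"
    and pairB_ract: "pairB e (rB f b) = pairB e f * b"
    and pairA_lact: "pairA (lA a f) e = a * pairA f e"
    and pairA_ract: "pairA f (rA e a) = pairA f e * a"
    and pairB_balanced: "pairB (rA e a) f = pairB e (lA a f)"
    and pairA_balanced: "pairA (rB f b) e = pairA f (lB b e)"
    and compat_left: "lB (pairB e f) e' = rA e (pairA f e')"
    and compat_right: "rB f (pairB e f') = lA (pairA f e) f'"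
    and pairB_full: "closed_span (pair_values pairB UNIV UNIV) = UNIV"
    and pairA_full: "closed_span (pair_values pairA UNIV UNIV) = UNIV"
    and lB_nondegenerate: "closed_span (pair_values lB UNIV UNIV) = UNIV"
    and rA_nondegenerate: "closed_span (pair_values rA UNIV UNIV) = UNIV"
    and lA_nondegenerate: "closed_span (pair_values lA UNIV UNIV) = UNIV"
    and rB_nondegenerate: "closed_span (pair_values rB UNIV UNIV) = UNIV"

(* right_submodule is E_I^> and left_submodule is _I E^<; Ind is Ind_B^A. *)
definition right_submodule :: "('el \<Rightarrow> 'er \<Rightarrow> 'b) \<Rightarrow> 'b set \<Rightarrow> 'er set" where
  "right_submodule pairB I = {\<xi>. \<forall>\<eta>. pairB \<eta> \<xi> \<in> I}"

definition left_submodule :: "('el \<Rightarrow> 'er \<Rightarrow> 'b) \<Rightarrow> 'b set \<Rightarrow> 'el set" where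
  "left_submodule pairB I = {\<eta>. \<forall>\<xi>. pairB \<eta> \<xi> \<in> I}"

definition Ind :: "('el \<Rightarrow> 'er \<Rightarrow> 'b) \<Rightarrow> ('er \<Rightarrow> 'el \<Rightarrow> 'a::complex_banach) \<Rightarrow> 'b set \<Rightarrow> 'a set" where
  "Ind pairB pairA I = closed_span (pair_values pairA (right_submodule pairB I) UNIV)"

end

theory Submission
  imports Defs
begin

text \<open>
  A nondegenerate module over a Banach algebra with a bounded approximate identity satisfies
  \<open>u\<^sub>i e \<longlonglongrightarrow> e\<close>. Approximating \<open>u\<^sub>i\<close> by sums of pairings and using
  \<open>\<^sub>A\<langle>f, e\<rangle> \<xi> = f \<langle>e, \<xi>\<rangle>\<^sub>B\<close> therefore shows that \<open>X\<close> is the closed span of \<open>E\<^sup>> I\<close>, and likewise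
  that \<open>Y\<close> is the closed span of \<open>I E\<^sup><\<close>. Hence \<open>\<langle>Y, X\<rangle>\<^sub>B\<close> spans \<open>I B I\<close>, which has the same closed
  span as \<open>I I\<close>. On the other side, \<open>J J\<close> is spanned by the products
  \<open>\<^sub>A\<langle>x, e\<rangle> \<^sub>A\<langle>x', e'\<rangle> = \<^sub>A\<langle>x, \<langle>e, x'\<rangle>\<^sub>B e'\<rangle>\<close>, which lie in \<open>\<^sub>A\<langle>X, Y\<rangle>\<close>, while
  \<open>\<^sub>A\<langle>f i \<langle>e, f'\<rangle>\<^sub>B, j e'\<rangle> = \<^sub>A\<langle>f i, e\<rangle> \<^sub>A\<langle>f' j, e'\<rangle>\<close> gives the converse inclusion.
\<close>

section \<open>Complex-linear maps, closed spans and contractive bilinear maps\<close>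

lemma bounded_linear_of_complex_linear:
  fixes f :: "'x::complex_banach \<Rightarrow> 'y::complex_banach"
  assumes "Vector_Spaces.linear scaleC scaleC f" and "\<And>x. norm (f x) \<le> K * norm x"
  shows "bounded_linear f"
proof -
  interpret Vector_Spaces.linear scaleC scaleC f by fact
  show ?thesis
  proof (rule bounded_linear_intro)
    show "f (r *\<^sub>R x) = r *\<^sub>R f x" for r x
      using scale[of "complex_of_real r" x] by (simp add: scaleC_of_real)
    show "norm (f x) \<le> norm x * K" for x
      using assms(2)[of x] by (simp add: mult.commute)
  qed (rule add)
qed

lemma bounded_linear_scaleC: "bounded_linear (\<lambda>x::'x::complex_banach. c *\<^sub>C x)"
proof (rule bounded_linear_intro)
  show "c *\<^sub>C r *\<^sub>R x = r *\<^sub>R c *\<^sub>C x" for r and x :: 'x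
    by (metis mult.commute scaleC_of_real scaleC_scaleC)
  show "norm (c *\<^sub>C x) \<le> norm x * cmod c" for x :: 'x
    by (simp add: norm_scaleC)
qed (rule scaleC_add_right)

lemma closed_closed_span [simp]: "closed (closed_span S)"
  by (simp add: closed_span_def)

lemma closed_span_superset: "x \<in> S \<Longrightarrow> x \<in> closed_span S"
  unfolding closed_span_def by (meson closure_subset complex_vector.span_base subsetD)

lemma subspace_closed_span [simp]: "complex_vector.subspace (closed_span S)"
  unfolding closed_span_def
proof (rule complex_vector.subspaceI)
  show "0 \<in> closure (complex_vector.span S)"
    by (meson closure_subset complex_vector.span_zero subsetD)
  fix x assume x: "x \<in> closure (complex_vector.span S)"
  then obtain xs where xs: "\<And>n. xs n \<in> complex_vector.span S" "xs \<longlonglongrightarrow> x"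
    by (auto simp: closure_sequential)
  show "c *\<^sub>C x \<in> closure (complex_vector.span S)" for c
    unfolding closure_sequential
    by (intro exI[of _ "\<lambda>n. c *\<^sub>C xs n"] conjI allI complex_vector.span_scale xs(1)
        bounded_linear.tendsto[OF bounded_linear_scaleC xs(2)])
  fix y assume "y \<in> closure (complex_vector.span S)"
  then obtain ys where ys: "\<And>n. ys n \<in> complex_vector.span S" "ys \<longlonglongrightarrow> y"
    by (auto simp: closure_sequential)
  show "x + y \<in> closure (complex_vector.span S)"
    unfolding closure_sequential
    by (intro exI[of _ "\<lambda>n. xs n + ys n"] conjI allI complex_vector.span_add xs(1) ys(1)
        tendsto_add[OF xs(2) ys(2)])
qed

lemma closed_span_minimal:
  assumes "S \<subseteq> V" "complex_vector.subspace V" "closed V"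
  shows "closed_span S \<subseteq> V"
  unfolding closed_span_def using assms
  by (intro closure_minimal complex_vector.span_minimal)

lemma closed_subspace_vimage:
  assumes "Vector_Spaces.linear scaleC scaleC f" "bounded_linear f"
    and "complex_vector.subspace V" "closed V"
  shows "complex_vector.subspace {x. f x \<in> V}" "closed {x. f x \<in> V}"
proof -
  interpret Vector_Spaces.linear scaleC scaleC f by fact
  show "complex_vector.subspace {x. f x \<in> V}"
    using assms(3) by (auto simp: complex_vector.subspace_def zero add scale)
  show "closed {x. f x \<in> V}"
    using continuous_closed_vimage[OF assms(4), of f] assms(2)
    by (simp add: vimage_def linear_continuous_at)
qed

lemma
  assumes "contractive_bilinear p"
  shows contractive_bilinear_linear_left: "Vector_Spaces.linear scaleC scaleC (\<lambda>x. p x y)"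
    and contractive_bilinear_linear_right: "Vector_Spaces.linear scaleC scaleC (p x)"
    and contractive_bilinear_norm: "norm (p x y) \<le> norm x * norm y"
    and contractive_bilinear_flip: "contractive_bilinear (\<lambda>y x. p x y)"
  using assms by (auto simp: contractive_bilinear_def mult.commute)

lemma
  assumes "contractive_bilinear p"
  shows contractive_bilinear_bounded_left: "bounded_linear (\<lambda>x. p x y)"
    and contractive_bilinear_bounded_right: "bounded_linear (p x)"
proof -
  show "bounded_linear (\<lambda>x. p x y)"
    using contractive_bilinear_linear_left[OF assms] contractive_bilinear_norm[OF assms]
    by (intro bounded_linear_of_complex_linear[where K = "norm y"]) (simp_all add: mult.commute)
  show "bounded_linear (p x)"
    using contractive_bilinear_linear_right[OF assms] contractive_bilinear_norm[OF assms]
    by (rule bounded_linear_of_complex_linear)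
qed

lemma contractive_bilinear_mult:
  "contractive_bilinear ((*) :: 'a::complex_banach_algebra \<Rightarrow> 'a \<Rightarrow> 'a)"
  unfolding contractive_bilinear_def Vector_Spaces.linear_iff
  by (auto simp: algebra_simps mult_scaleC_left mult_scaleC_right norm_mult_ineq
      complex_vector.vector_space_axioms)

text \<open>Preimages of \<open>V\<close> under the two partial maps are closed subspaces, so one
  variable at a time can be extended from generators to the closed span. Most membership proofs
  below reduce to generators this way.\<close>

lemma bilinear_closed_span_subset:
  assumes p: "contractive_bilinear p" and V: "complex_vector.subspace V" "closed V"
    and S: "\<And>s t. s \<in> S \<Longrightarrow> t \<in> T \<Longrightarrow> p s t \<in> V"
    and "x \<in> closed_span S" "y \<in> closed_span T"
  shows "p x y \<in> V"
proof -
  note left = closed_subspace_vimage[OF contractive_bilinear_linear_left[OF p]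
      contractive_bilinear_bounded_left[OF p] V]
  note right = closed_subspace_vimage[OF contractive_bilinear_linear_right[OF p]
      contractive_bilinear_bounded_right[OF p] V]
  have "closed_span T \<subseteq> {y. p s y \<in> V}" if "s \<in> S" for s
    by (rule closed_span_minimal) (use S that right in auto)
  then have "closed_span S \<subseteq> {x. p x y \<in> V}"
    by (intro closed_span_minimal left) (use \<open>y \<in> closed_span T\<close> in auto)
  then show ?thesis
    using \<open>x \<in> closed_span S\<close> by auto
qed

section \<open>Nets and approximate identities acting on a module\<close>

lemma net_filter_neq_bot: "directed_set D le \<Longrightarrow> net_filter D le \<noteq> bot"
  unfolding trivial_limit_def by (metis directed_set_def eventually_net_filter)

text \<open>The filter lives on the whole index type, whereas the norm bound on an approximate
  identity is given only for indices in \<open>D\<close>.\<close>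

lemma eventually_net_filter_carrier:
  "directed_set D le \<Longrightarrow> eventually (\<lambda>i. i \<in> D) (net_filter D le)"
  by (metis directed_set_def eventually_net_filter ex_in_conv)

lemma mem_of_approximate_identity:
  assumes bai: "bounded_approximate_identity D le u"
    and "((\<lambda>i. p (u i) x) \<longlongrightarrow> x) (net_filter D le)"
    and "closed V" "\<And>a. p a x \<in> V"
  shows "x \<in> V"
proof -
  have "net_filter D le \<noteq> bot"
    using bai by (auto simp: bounded_approximate_identity_def intro!: net_filter_neq_bot)
  then show ?thesis
    using Lim_in_closed_set[OF assms(3) _ _ assms(2)] assms(4) by simp
qed

text \<open>Boundedness of the approximate identity enters here: it makes the set of vectors on which it
  acts as an approximate identity closed.\<close>
lemma approximate_identity_module:
  fixes p :: "'a::complex_banach_algebra \<Rightarrow> 'e::complex_banach \<Rightarrow> 'e"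
  assumes bai: "bounded_approximate_identity D le u" and p: "contractive_bilinear p"
    and S: "\<And>s. s \<in> S \<Longrightarrow> ((\<lambda>i. p (u i) s) \<longlongrightarrow> s) (net_filter D le)"
    and x: "x \<in> closed_span S"
  shows "((\<lambda>i. p (u i) x) \<longlongrightarrow> x) (net_filter D le)"
proof -
  have D: "directed_set D le" and "bounded (u ` D)"
    using bai unfolding bounded_approximate_identity_def by blast+
  then obtain K where "K > 0" and K: "\<And>i. i \<in> D \<Longrightarrow> norm (u i) \<le> K"
    unfolding bounded_pos by auto
  interpret p: Vector_Spaces.linear scaleC scaleC "p a" for a
    by (rule contractive_bilinear_linear_right[OF p])
  let ?F = "net_filter D le"
  let ?V = "{x. ((\<lambda>i. p (u i) x) \<longlongrightarrow> x) ?F}"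
  have "complex_vector.subspace ?V"
    by (auto simp: complex_vector.subspace_def p.zero p.add p.scale
        intro: tendsto_add bounded_linear.tendsto[OF bounded_linear_scaleC])
  moreover have "closed ?V"
    unfolding closed_sequential_limits
  proof (intro allI impI, elim conjE)
    fix xs x assume xs: "\<forall>n. xs n \<in> ?V" "xs \<longlonglongrightarrow> x"
    have "((\<lambda>i. p (u i) x) \<longlongrightarrow> x) ?F"
    proof (rule tendstoI)
      fix \<epsilon> :: real assume "\<epsilon> > 0"
      \<comment> \<open>Splitting \<open>p (u i) x - x\<close> through \<open>xs n\<close> leaves
        two terms bounded together by \<open>(K + 1) * norm (x - xs n)\<close>; this choice makes
        them cost less than half of \<open>\<epsilon>\<close>, the other half going to the
        convergence at \<open>xs n\<close>.\<close>
      then have "\<epsilon> / (2 * (K + 1)) > 0"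
        using \<open>K > 0\<close> by simp
      then obtain n where "norm (xs n - x) < \<epsilon> / (2 * (K + 1))"
        using LIMSEQ_D[OF xs(2)] by blast
      then have n: "(K + 1) * norm (x - xs n) < \<epsilon> / 2"
        using \<open>K > 0\<close> by (simp add: field_simps norm_minus_commute)
      have "eventually (\<lambda>i. dist (p (u i) (xs n)) (xs n) < \<epsilon> / 2) ?F"
        using xs(1) \<open>\<epsilon> > 0\<close> by (intro tendstoD) simp_all
      then show "eventually (\<lambda>i. dist (p (u i) x) x < \<epsilon>) ?F"
        using eventually_net_filter_carrier[OF D]
      proof eventually_elim
        case (elim i)
        have "norm (p (u i) (x - xs n)) \<le> K * norm (x - xs n)"
          using contractive_bilinear_norm[OF p] K[OF elim(2)]
          by (meson mult_right_mono norm_ge_zero order_trans)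
        moreover have "p (u i) x - x = p (u i) (x - xs n) + (p (u i) (xs n) - xs n) - (x - xs n)"
          by (simp add: p.diff)
        then have "norm (p (u i) x - x)
            \<le> norm (p (u i) (x - xs n)) + norm (p (u i) (xs n) - xs n) + norm (x - xs n)"
          by (metis add_right_mono norm_triangle_ineq norm_triangle_ineq4 order_trans)
        ultimately show ?case
          using n elim(1) by (simp add: dist_norm algebra_simps)
      qed
    qed
    then show "x \<in> ?V" by simp
  qed
  ultimately have "closed_span S \<subseteq> ?V"
    using S by (intro closed_span_minimal) auto
  then show ?thesis
    using x by auto
qed

lemma closed_span_pair_valuesI:
  "s \<in> S \<Longrightarrow> t \<in> T \<Longrightarrow> p s t \<in> closed_span (pair_values p S T)"
  by (rule closed_span_superset) (auto simp: pair_values_def)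

lemma closed_span_pair_values_subset:
  assumes "\<And>s t. s \<in> S \<Longrightarrow> t \<in> T \<Longrightarrow> p s t \<in> V" "complex_vector.subspace V" "closed V"
  shows "closed_span (pair_values p S T) \<subseteq> V"
  by (rule closed_span_minimal) (use assms in \<open>auto simp: pair_values_def\<close>)

context morita_equivalence
begin

section \<open>Approximate identities on the two modules, and the submodules as closed spans\<close>

text \<open>On a product, \<open>u i\<close> acts by multiplying the algebra factor, where
  convergence is known; nondegeneracy extends this to the whole module.\<close>

lemma approximate_identity_lA:
  fixes u :: "'i \<Rightarrow> 'a"
  assumes "bounded_approximate_identity D le u"
  shows "((\<lambda>i. lA (u i) \<xi>) \<longlongrightarrow> \<xi>) (net_filter D le)"
proof (rule approximate_identity_module[where S = "pair_values lA UNIV UNIV"])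
  fix s assume "s \<in> pair_values lA UNIV UNIV"
  then obtain a f where s: "s = lA a f"
    by (auto simp: pair_values_def)
  have "((\<lambda>i. lA (u i * a) f) \<longlongrightarrow> lA a f) (net_filter D le)"
    using assms bounded_linear.tendsto[OF contractive_bilinear_bounded_left[OF right.lact_bilinear]]
    unfolding bounded_approximate_identity_def by blast
  then show "((\<lambda>i. lA (u i) s) \<longlongrightarrow> s) (net_filter D le)"
    by (simp add: s right.lact_assoc)
qed (use assms right.lact_bilinear lA_nondegenerate in auto)

lemma approximate_identity_rA:
  fixes u :: "'i \<Rightarrow> 'a"
  assumes "bounded_approximate_identity D le u"
  shows "((\<lambda>i. rA \<eta> (u i)) \<longlongrightarrow> \<eta>) (net_filter D le)"
\<comment> \<open>The module lemma asks only that \<open>p\<close> be bilinear and contractive, so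
  it accepts the right action with its arguments swapped.\<close>
proof (rule approximate_identity_module[where S = "pair_values rA UNIV UNIV" and p = "\<lambda>a e. rA e a"])
  fix s assume "s \<in> pair_values rA UNIV UNIV"
  then obtain e a where s: "s = rA e a"
    by (auto simp: pair_values_def)
  have "((\<lambda>i. rA e (a * u i)) \<longlongrightarrow> rA e a) (net_filter D le)"
    using assms bounded_linear.tendsto[OF contractive_bilinear_bounded_right[OF left.ract_bilinear]]
    unfolding bounded_approximate_identity_def by blast
  then show "((\<lambda>i. rA s (u i)) \<longlongrightarrow> s) (net_filter D le)"
    by (simp add: s left.ract_assoc)
qed (use assms contractive_bilinear_flip[OF left.ract_bilinear] rA_nondegenerate in auto)

text \<open>For \<open>a = pairA f e\<close>, compatibility turns \<open>lA a \<xi>\<close> into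
  \<open>rB f (pairB e \<xi>)\<close>, whose coefficient lies in \<open>I\<close>. Fullness of
  \<open>pairA\<close> gives all \<open>a\<close>, and the approximate identity of the first algebra
  recovers \<open>\<xi>\<close> itself.\<close>

lemma right_submodule_subset:
  fixes u :: "'i \<Rightarrow> 'a"
  assumes "bounded_approximate_identity D le u"
  shows "right_submodule pairB I \<subseteq> closed_span (pair_values rB UNIV I)"
proof
  fix \<xi> assume \<xi>: "\<xi> \<in> right_submodule pairB I"
  have "lA a \<xi> \<in> closed_span (pair_values rB UNIV I)" for a
  proof (rule bilinear_closed_span_subset[OF right.lact_bilinear,
        where S = "pair_values pairA UNIV UNIV" and T = "{\<xi>}"])
    fix s t assume "s \<in> pair_values pairA UNIV UNIV" "t \<in> {\<xi>}"
    then obtain f e where "s = pairA f e" "t = \<xi>"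
      by (auto simp: pair_values_def)
    then show "lA s t \<in> closed_span (pair_values rB UNIV I)"
      using \<xi> by (auto simp: compat_right[symmetric] right_submodule_def intro: closed_span_pair_valuesI)
  qed (auto simp: pairA_full intro: closed_span_superset)
  then show "\<xi> \<in> closed_span (pair_values rB UNIV I)"
    using mem_of_approximate_identity[where p = lA, OF assms approximate_identity_lA[OF assms]]
    by simp
qed

text \<open>The mirror image: \<open>compat_left\<close> turns \<open>rA \<eta> (pairA f e)\<close>
  into \<open>lB (pairB \<eta> f) e\<close>.\<close>

lemma left_submodule_subset:
  fixes u :: "'i \<Rightarrow> 'a"
  assumes "bounded_approximate_identity D le u"
  shows "left_submodule pairB I \<subseteq> closed_span (pair_values lB I UNIV)"
proof
  fix \<eta> assume \<eta>: "\<eta> \<in> left_submodule pairB I"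
  have "rA \<eta> a \<in> closed_span (pair_values lB I UNIV)" for a
  proof (rule bilinear_closed_span_subset[OF left.ract_bilinear,
        where S = "{\<eta>}" and T = "pair_values pairA UNIV UNIV"])
    fix s t assume "s \<in> {\<eta>}" "t \<in> pair_values pairA UNIV UNIV"
    then obtain f e where "t = pairA f e" "s = \<eta>"
      by (auto simp: pair_values_def)
    then show "rA s t \<in> closed_span (pair_values lB I UNIV)"
      using \<eta> by (auto simp: compat_left[symmetric] left_submodule_def intro: closed_span_pair_valuesI)
  qed (auto simp: pairA_full intro: closed_span_superset)
  then show "\<eta> \<in> closed_span (pair_values lB I UNIV)"
    using mem_of_approximate_identity[where p = "\<lambda>a e. rA e a",
        OF assms approximate_identity_rA[OF assms]]
    by simp
qed

lemma rB_in_right_submodule: "closed_ideal I \<Longrightarrow> i \<in> I \<Longrightarrow> rB f i \<in> right_submodule pairB I"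
  by (auto simp: right_submodule_def pairB_ract closed_ideal_def)

lemma lB_in_left_submodule: "closed_ideal I \<Longrightarrow> i \<in> I \<Longrightarrow> lB i e \<in> left_submodule pairB I"
  by (auto simp: left_submodule_def pairB_lact closed_ideal_def)

lemma pairA_in_Ind: "x \<in> right_submodule pairB I \<Longrightarrow> pairA x e \<in> Ind pairB pairA I"
  unfolding Ind_def by (rule closed_span_pair_valuesI) auto

section \<open>The induced ideal\<close>

text \<open>A left factor moves into the first argument of \<open>pairA\<close>, which stays in the
  submodule because \<open>pairB\<close> is balanced; a right factor is absorbed by the second
  argument, which ranges over the whole module.\<close>

lemma closed_ideal_Ind: "closed_ideal (Ind pairB pairA I)"
proof -
  let ?J = "Ind pairB pairA I" and ?S = "pair_values pairA (right_submodule pairB I) UNIV"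
  have J: "complex_vector.subspace ?J" "closed ?J"
    by (simp_all add: Ind_def)
  have "a * x \<in> ?J" if "x \<in> ?J" for a x
  proof (rule bilinear_closed_span_subset[OF contractive_bilinear_mult J, where S = "{a}" and T = ?S])
    fix s t assume "s \<in> {a}" "t \<in> ?S"
    then obtain f e where "s = a" "t = pairA f e" "lA a f \<in> right_submodule pairB I"
      by (auto simp: pair_values_def right_submodule_def pairB_balanced[symmetric])
    then show "s * t \<in> ?J"
      using pairA_in_Ind[of "lA a f" I e] by (simp add: pairA_lact)
  qed (use that in \<open>auto simp: Ind_def intro: closed_span_superset\<close>)
  moreover have "x * a \<in> ?J" if "x \<in> ?J" for a x
  proof (rule bilinear_closed_span_subset[OF contractive_bilinear_mult J, where S = ?S and T = "{a}"])
    fix s t assume "s \<in> ?S" "t \<in> {a}"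
    then obtain f e where "t = a" "s = pairA f e" "f \<in> right_submodule pairB I"
      by (auto simp: pair_values_def)
    then show "s * t \<in> ?J"
      using pairA_in_Ind[of f I "rA e a"] by (simp add: pairA_ract)
  qed (use that in \<open>auto simp: Ind_def intro: closed_span_superset\<close>)
  ultimately show ?thesis
    using J by (simp add: closed_ideal_def)
qed

section \<open>The two pairings and the squares of the ideals\<close>

text \<open>Since \<open>i * j\<close> is the limit of \<open>i * v k * j\<close> and each
  \<open>v k\<close> is a limit of sums of pairings, it suffices to test products with one pairing
  inserted in the middle. The map \<open>f\<close> is the identity for \<open>pairB\<close>, and
  \<open>\<lambda>b. pairA (rB g b) e\<close> for \<open>pairA\<close>.\<close>

lemma sandwich_mem:
  fixes v :: "'i \<Rightarrow> 'b"
  assumes bai: "bounded_approximate_identity D le v"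
    and f: "Vector_Spaces.linear scaleC scaleC f" "bounded_linear f"
    and V: "complex_vector.subspace V" "closed V"
    and mem: "\<And>e e'. f (i * pairB e e' * j) \<in> V"
  shows "f (i * j) \<in> V"
proof -
  let ?W = "{x. f x \<in> V}"
  note W = closed_subspace_vimage[OF f V]
  have "i * (b * j) \<in> ?W" for b
  proof -
    have "b \<in> closed_span (pair_values pairB UNIV UNIV)"
      by (simp add: pairB_full)
    moreover have "j \<in> closed_span {j}"
      by (auto intro: closed_span_superset)
    ultimately have "b * j \<in> {x. i * x \<in> ?W}"
    proof (rule bilinear_closed_span_subset[OF contractive_bilinear_mult, rotated 3])
      show "s * t \<in> {x. i * x \<in> ?W}" if "s \<in> pair_values pairB UNIV UNIV" "t \<in> {j}" for s t
        using that mem by (auto simp: pair_values_def mult.assoc)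
    qed (rule closed_subspace_vimage[OF contractive_bilinear_linear_right
          [OF contractive_bilinear_mult] contractive_bilinear_bounded_right
          [OF contractive_bilinear_mult] W])+
    then show ?thesis by simp
  qed
  moreover have "((\<lambda>k. v k * j) \<longlongrightarrow> j) (net_filter D le)"
    using bai by (auto simp: bounded_approximate_identity_def)
  moreover have "closed {x. i * x \<in> ?W}"
    by (rule closed_subspace_vimage(2)[OF contractive_bilinear_linear_right
          [OF contractive_bilinear_mult] contractive_bilinear_bounded_right
          [OF contractive_bilinear_mult] W])
  ultimately have "j \<in> {x. i * x \<in> ?W}"
    using mem_of_approximate_identity[OF bai, where p = "(*)" and x = j
        and V = "{x. i * x \<in> ?W}"] by simp
  then show ?thesis by simp
qed

lemma closed_span_pairB_eq_ideal_square:
  fixes u :: "'i \<Rightarrow> 'a" and v :: "'j \<Rightarrow> 'b"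
  assumes baiA: "bounded_approximate_identity DA leA u"
    and baiB: "bounded_approximate_identity DB leB v"
    and I: "closed_ideal I"
  shows "closed_span (pair_values pairB (left_submodule pairB I) (right_submodule pairB I))
    = ideal_square I" (is "closed_span (pair_values pairB ?Y ?X) = _")
proof
  show "closed_span (pair_values pairB ?Y ?X) \<subseteq> ideal_square I"
  proof (rule closed_span_pair_values_subset)
    fix y x assume "y \<in> ?Y" "x \<in> ?X"
    then have "y \<in> closed_span (pair_values lB I UNIV)" "x \<in> closed_span (pair_values rB UNIV I)"
      using left_submodule_subset[OF baiA] right_submodule_subset[OF baiA] by auto
    then show "pairB y x \<in> ideal_square I"
    proof (rule bilinear_closed_span_subset[OF pairB_bilinear, rotated 3])
      fix s t assume "s \<in> pair_values lB I UNIV" "t \<in> pair_values rB UNIV I"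
      then obtain i e f j where "s = lB i e" "t = rB f j" "i \<in> I" "j \<in> I"
        by (auto simp: pair_values_def)
      \<comment> \<open>The value is \<open>(i * pairB e f) * j\<close>; absorbing the pairing into
        the left factor exhibits a product of two elements of \<open>I\<close>.\<close>
      then show "pairB s t \<in> ideal_square I"
        using I closed_span_pair_valuesI[of "i * pairB e f" I j I "(*)"]
        by (simp add: pairB_lact pairB_ract ideal_square_def closed_ideal_def mult.assoc)
    qed (simp_all add: ideal_square_def)
  qed (simp_all add: ideal_square_def)
  show "ideal_square I \<subseteq> closed_span (pair_values pairB ?Y ?X)"
    unfolding ideal_square_def
  proof (rule closed_span_pair_values_subset)
    fix i j assume ij: "i \<in> I" "j \<in> I"
    show "i * j \<in> closed_span (pair_values pairB ?Y ?X)"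
    \<comment> \<open>With a pairing inserted, the product becomes
      \<open>pairB (lB i e) (rB f j)\<close>, a value on the two submodules.\<close>
    proof (rule sandwich_mem[OF baiB, where f = "\<lambda>x. x"])
      fix e f
      show "i * pairB e f * j \<in> closed_span (pair_values pairB ?Y ?X)"
        using closed_span_pair_valuesI[OF lB_in_left_submodule[OF I ij(1), of e]
            rB_in_right_submodule[OF I ij(2), of f], of pairB]
        by (simp add: pairB_lact pairB_ract mult.assoc)
    qed (simp_all add: complex_vector.linear_ident)
  qed simp_all
qed

lemma closed_span_pairA_eq_ideal_square:
  fixes u :: "'i \<Rightarrow> 'a" and v :: "'j \<Rightarrow> 'b"
  assumes baiA: "bounded_approximate_identity DA leA u"
    and baiB: "bounded_approximate_identity DB leB v"
    and I: "closed_ideal I"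
  shows "closed_span (pair_values pairA (right_submodule pairB I) (left_submodule pairB I))
    = ideal_square (Ind pairB pairA I)" (is "closed_span (pair_values pairA ?X ?Y) = ideal_square ?J")
proof
  show "closed_span (pair_values pairA ?X ?Y) \<subseteq> ideal_square ?J"
  proof (rule closed_span_pair_values_subset)
    fix x y assume "x \<in> ?X" "y \<in> ?Y"
    then have "x \<in> closed_span (pair_values rB UNIV I)" "y \<in> closed_span (pair_values lB I UNIV)"
      using left_submodule_subset[OF baiA] right_submodule_subset[OF baiA] by auto
    then show "pairA x y \<in> ideal_square ?J"
    proof (rule bilinear_closed_span_subset[OF pairA_bilinear, rotated 3])
      fix s t assume "s \<in> pair_values rB UNIV I" "t \<in> pair_values lB I UNIV"
      then obtain g i j e where st: "s = rB g i" "t = lB j e" and ij: "i \<in> I" "j \<in> I"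
        by (auto simp: pair_values_def)
      \<comment> \<open>Balancedness moves \<open>j\<close> across \<open>pairA\<close>, so
        \<open>pairA s t\<close> equals this value, with \<open>i * j\<close> in one place ready for
        the sandwich argument.\<close>
      have "pairA (rB g (i * j)) e \<in> ideal_square ?J"
      proof (rule sandwich_mem[OF baiB, where f = "\<lambda>b. pairA (rB g b) e"])
        show "Vector_Spaces.linear scaleC scaleC (\<lambda>b. pairA (rB g b) e)"
          using Vector_Spaces.linear_compose[OF
              contractive_bilinear_linear_right[OF right.ract_bilinear, of g]
              contractive_bilinear_linear_left[OF pairA_bilinear, of e]]
          by (simp add: o_def)
        show "bounded_linear (\<lambda>b. pairA (rB g b) e)"
          by (rule bounded_linear_compose[OF contractive_bilinear_bounded_left[OF pairA_bilinear]
                contractive_bilinear_bounded_right[OF right.ract_bilinear]])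
        fix e' f'
        \<comment> \<open>The inserted pairing splits the value: \<open>compat_right\<close> trades
          it for an outer left action by \<open>pairA (rB g i) e'\<close>, which then leaves
          \<open>pairA\<close> as a factor. Both \<open>rB g i\<close> and \<open>rB f' j\<close>
          lie in the right submodule, so each factor lies in the induced ideal.\<close>
        have "pairA (rB g (i * pairB e' f' * j)) e = pairA (rB g i) e' * pairA (rB f' j) e"
          by (simp add: right.ract_assoc compat_right right.lact_ract pairA_lact)
        then show "pairA (rB g (i * pairB e' f' * j)) e \<in> ideal_square ?J"
          unfolding ideal_square_def
          using ij by (auto intro!: closed_span_pair_valuesI pairA_in_Ind rB_in_right_submodule[OF I])
      qed (simp_all add: ideal_square_def)
      then show "pairA s t \<in> ideal_square ?J"
        by (simp add: st pairA_balanced[symmetric] right.ract_assoc)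
    qed (simp_all add: ideal_square_def)
  qed (simp_all add: ideal_square_def)
  show "ideal_square ?J \<subseteq> closed_span (pair_values pairA ?X ?Y)"
    unfolding ideal_square_def
  proof (rule closed_span_pair_values_subset)
    fix a b assume "a \<in> ?J" "b \<in> ?J"
    then show "a * b \<in> closed_span (pair_values pairA ?X ?Y)"
      unfolding Ind_def
    proof (rule bilinear_closed_span_subset[OF contractive_bilinear_mult, rotated 3])
      fix s t assume "s \<in> pair_values pairA ?X UNIV" "t \<in> pair_values pairA ?X UNIV"
      then obtain x e x' e' where "s = pairA x e" "t = pairA x' e'" "x \<in> ?X" "x' \<in> ?X"
        by (auto simp: pair_values_def)
      \<comment> \<open>This witness comes from
        \<open>pairA x e * pairA x' e' = pairA x (rA e (pairA x' e'))\<close> and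
        \<open>compat_left\<close>; its coefficient \<open>pairB e x'\<close> is in \<open>I\<close>
        because \<open>x'\<close> is in the right submodule.\<close>
      moreover from this have "lB (pairB e x') e' \<in> ?Y"
        by (intro lB_in_left_submodule[OF I]) (auto simp: right_submodule_def)
      ultimately show "s * t \<in> closed_span (pair_values pairA ?X ?Y)"
        using closed_span_pair_valuesI[of x ?X "lB (pairB e x') e'" ?Y pairA]
        by (simp add: compat_left pairA_ract)
    qed simp_all
  qed simp_all
qed

end

theorem lemma2p11:
  fixes u :: "'i \<Rightarrow> 'a::complex_banach_algebra"
    and v :: "'j \<Rightarrow> 'b::complex_banach_algebra"
    and lB :: "'b \<Rightarrow> 'el::complex_banach \<Rightarrow> 'el"
    and rA :: "'el \<Rightarrow> 'a \<Rightarrow> 'el"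
    and lA :: "'a \<Rightarrow> 'er::complex_banach \<Rightarrow> 'er"
    and rB :: "'er \<Rightarrow> 'b \<Rightarrow> 'er"
    and pairB :: "'el \<Rightarrow> 'er \<Rightarrow> 'b"
    and pairA :: "'er \<Rightarrow> 'el \<Rightarrow> 'a"
    and I :: "'b set" and J :: "'a set" and X :: "'er set" and Y :: "'el set"
  assumes "bounded_approximate_identity DA leA u"
    and "bounded_approximate_identity DB leB v"
    and "morita_equivalence lB rA lA rB pairB pairA"
    and "closed_ideal I"
    and "J = Ind pairB pairA I"
    and "X = right_submodule pairB I"
    and "Y = left_submodule pairB I"
  shows "closed_ideal J
    \<and> pair_values pairB Y X \<subseteq> I
    \<and> pair_values pairA X Y \<subseteq> J
    \<and> closed_span (pair_values pairB Y X) = ideal_square I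
    \<and> closed_span (pair_values pairA X Y) = ideal_square J"
proof -
  interpret morita_equivalence lB rA lA rB pairB pairA by fact
  \<comment> \<open>Of the two restriction claims, the one for \<open>pairB\<close> is the
    definition of \<open>Y\<close>, and the one for \<open>pairA\<close> holds because
    \<open>J\<close> contains \<open>pairA x e\<close> for every \<open>x\<close> in
    \<open>X\<close> and arbitrary \<open>e\<close>.\<close>
  show ?thesis
    using closed_ideal_Ind[of I] assms
      closed_span_pairB_eq_ideal_square[OF assms(1,2,4)]
      closed_span_pairA_eq_ideal_square[OF assms(1,2,4)]
    by (auto simp: pair_values_def left_submodule_def intro: pairA_in_Ind)
qed

end
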